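(* Let $p \colon E \to B$ be a principal $G$-bundle, where $G$ is a connected Lie group. Then $$\mathrm{TC}^{M}[p \colon E \to B] = \mathrm{TC}[p \colon E \to B] = \mathrm{TC}^{M}(G) = \mathrm{TC}(G) = \mathrm{cat}(G).$$
   Context: $I=[0,1]$; $\mathrm{c}_e$ is the constant path at $e$; path spaces have the compact-open topology; all invariants below are $\infty$ when no such integer exists. For $p \colon E \to B$: $E \times_B E = \{(e_1,e_2)\in E\times E \mid p(e_1)=p(e_2)\}$ with diagonal $\Delta E = \{(e,e)\mid e \in E\}$; $E^I_B = \{\gamma \in E^I \mid p\circ\gamma \text{ is constant}\}$; $\Pi \colon E^I_B \to E \times_B E$, $\Pi(\gamma) = (\gamma(0),\gamma(1))$. $\mathrm{TC}[p \colon E\to B]$ (parametrized topological complexity) is the sectional category of $\Pi$: the least nonnegative integer $n$ such that $E \times_B E$ has an open cover $\{U_0,\dots,U_n\}$ with a continuous section of $\Pi$ over each $U_i$. $\mathrm{TC}^{M}[p \colon E\to B]$ (monoidal parametrized topological complexity) is the least nonnegative integer $n$ such that $E \times_B E$ may be covered by open subsets $U_0,\dots,U_n$, each containing $\Delta E$ and admitting a section $\sigma_i \colon U_i \to E^I_B$ of $\Pi$ with $\sigma_i(e,e) = \mathrm{c}_e$ for all $e \in E$. For a space $X$, $\mathrm{TC}(X)$ and $\mathrm{TC}^M(X)$ are the invariants above for the map $X \to \{*\}$ to a point (so $\Pi$ is the free path fibration $X^I \to X\times X$). $\mathrm{cat}(X)$ is the (normalized) Lusternik–Schnirelmann category: the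 least $n$ such that $X$ has an open cover $\{U_0,\dots,U_n\}$ with each inclusion $U_i \hookrightarrow X$ null-homotopic. *)

theory Defs
  imports "HOL-Analysis.Analysis" "HOL-Algebra.Group" "HOL-Library.Extended_Nat"
begin

section \<open>Smooth manifolds and Lie groups\<close>

text \<open>
  The model spaces are the library's \<^term>\<open>Euclidean_space n\<close>, i.e. the real sequences that vanish
  from index \<open>n\<close> on. In contrast to the class \<^class>\<open>euclidean_space\<close> this includes dimension 0.
  A real function on an open subset \<open>W\<close> is of class \<open>C\<^sup>k\<close> if it is continuous there and, for
  positive \<open>k\<close>, all its first partial derivatives exist on \<open>W\<close> and are of class \<open>C\<^sup>k\<^sup>-\<^sup>1\<close>.
\<close>

primrec Ck_on :: "nat \<Rightarrow> nat \<Rightarrow> (nat \<Rightarrow> real) set \<Rightarrow> ((nat \<Rightarrow> real) \<Rightarrow> real) \<Rightarrow> bool" where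
  "Ck_on 0 n W f \<longleftrightarrow>
     continuous_map (subtopology (Euclidean_space n) W) euclideanreal f"
| "Ck_on (Suc k) n W f \<longleftrightarrow>
     continuous_map (subtopology (Euclidean_space n) W) euclideanreal f \<and>
     (\<forall>i<n. \<exists>D. (\<forall>x\<in>W. ((\<lambda>t. f (x(i := t))) has_real_derivative D x) (at (x i))) \<and>
                Ck_on k n W D)"

definition smooth_map_Euclidean ::
  "nat \<Rightarrow> nat \<Rightarrow> (nat \<Rightarrow> real) set \<Rightarrow> ((nat \<Rightarrow> real) \<Rightarrow> (nat \<Rightarrow> real)) \<Rightarrow> bool" where
  "smooth_map_Euclidean n m W F \<longleftrightarrow> (\<forall>j<m. \<forall>k. Ck_on k n W (\<lambda>x. F x j))"

text \<open>A chart is given by its domain and a coordinate map, which is only relevant on the domain.\<close>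

type_synonym 'a chart = "'a set \<times> ('a \<Rightarrow> nat \<Rightarrow> real)"

definition is_chart :: "nat \<Rightarrow> 'a topology \<Rightarrow> 'a chart \<Rightarrow> bool" where
  "is_chart n X c \<longleftrightarrow> (case c of (U, \<phi>) \<Rightarrow>
     openin X U \<and> openin (Euclidean_space n) (\<phi> ` U) \<and>
     homeomorphic_map (subtopology X U) (subtopology (Euclidean_space n) (\<phi> ` U)) \<phi>)"

text \<open>An atlas is not required to be maximal; it determines a unique maximal one.\<close>

definition smooth_manifold :: "nat \<Rightarrow> 'a topology \<Rightarrow> 'a chart set \<Rightarrow> bool" where
  "smooth_manifold n X A \<longleftrightarrow>
     Hausdorff_space X \<and> second_countable X \<and>
     (\<forall>c\<in>A. is_chart n X c) \<and> (\<Union>(U, \<phi>)\<in>A. U) = topspace X \<and>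
     (\<forall>(U, \<phi>)\<in>A. \<forall>(V, \<psi>)\<in>A.
        smooth_map_Euclidean n n (\<phi> ` (U \<inter> V)) (\<psi> \<circ> inv_into U \<phi>))"

definition smooth_map ::
  "nat \<Rightarrow> 'a topology \<Rightarrow> 'a chart set \<Rightarrow> nat \<Rightarrow> 'b topology \<Rightarrow> 'b chart set \<Rightarrow> ('a \<Rightarrow> 'b) \<Rightarrow> bool"
  where
  "smooth_map n X A m Y A' f \<longleftrightarrow>
     continuous_map X Y f \<and>
     (\<forall>(U, \<phi>)\<in>A. \<forall>(V, \<psi>)\<in>A'.
        smooth_map_Euclidean n m (\<phi> ` (U \<inter> f -` V)) (\<psi> \<circ> f \<circ> inv_into U \<phi>))"

text \<open>Coordinates on a product: those of the first factor, followed by those of the second.\<close>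

definition prod_atlas :: "nat \<Rightarrow> 'a chart set \<Rightarrow> 'b chart set \<Rightarrow> ('a \<times> 'b) chart set" where
  "prod_atlas n A A' =
     {(U \<times> V, \<lambda>(x, y) i. if i < n then \<phi> x i else \<psi> y (i - n)) | U \<phi> V \<psi>.
        (U, \<phi>) \<in> A \<and> (V, \<psi>) \<in> A'}"

definition lie_group ::
  "('g, 'r) monoid_scheme \<Rightarrow> 'g topology \<Rightarrow> nat \<Rightarrow> 'g chart set \<Rightarrow> bool" where
  "lie_group G T n A \<longleftrightarrow>
     group G \<and> topspace T = carrier G \<and> smooth_manifold n T A \<and>
     smooth_map (n + n) (prod_topology T T) (prod_atlas n A A) n T A (\<lambda>(x, y). x \<otimes>\<^bsub>G\<^esub> y) \<and>
     smooth_map n T A n T A (m_inv G)"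


section \<open>Principal bundles\<close>

text \<open>The structure group acts on the total space from the right.\<close>

definition principal_bundle ::
  "('g, 'r) monoid_scheme \<Rightarrow> 'g topology \<Rightarrow> 'e topology \<Rightarrow> 'b topology \<Rightarrow>
   ('e \<Rightarrow> 'b) \<Rightarrow> ('e \<Rightarrow> 'g \<Rightarrow> 'e) \<Rightarrow> bool" where
  "principal_bundle G T E B p act \<longleftrightarrow>
     continuous_map E B p \<and>
     continuous_map (prod_topology E T) E (\<lambda>(e, g). act e g) \<and>
     (\<forall>e\<in>topspace E. act e \<one>\<^bsub>G\<^esub> = e) \<and>
     (\<forall>e\<in>topspace E. \<forall>g\<in>carrier G. \<forall>h\<in>carrier G. act (act e g) h = act e (g \<otimes>\<^bsub>G\<^esub> h)) \<and>
     (\<forall>e\<in>topspace E. \<forall>g\<in>carrier G. p (act e g) = p e) \<and>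
     (\<forall>b\<in>topspace B. \<exists>U \<phi>. openin B U \<and> b \<in> U \<and>
        homeomorphic_map (subtopology E (p -` U)) (prod_topology (subtopology B U) T) \<phi> \<and>
        (\<forall>e\<in>topspace E. p e \<in> U \<longrightarrow> fst (\<phi> e) = p e \<and>
           (\<forall>g\<in>carrier G. \<phi> (act e g) = (fst (\<phi> e), snd (\<phi> e) \<otimes>\<^bsub>G\<^esub> g))))"


section \<open>Path spaces\<close>

text \<open>
  Continuous maps are represented by functions that are \<^term>\<open>undefined\<close> outside the domain.
  The sets in the subbase with \<open>K = {}\<close> and \<open>U = {}\<close> make the whole function set open.
\<close>

definition compact_open_topology :: "'a topology \<Rightarrow> 'b topology \<Rightarrow> ('a \<Rightarrow> 'b) topology" where
  "compact_open_topology X Y = topology_generated_by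
     {{f \<in> extensional (topspace X). continuous_map X Y f \<and> f ` K \<subseteq> U} | K U.
        compactin X K \<and> openin Y U}"

lemma topspace_compact_open_topology:
  "topspace (compact_open_topology X Y) = {f \<in> extensional (topspace X). continuous_map X Y f}"
proof -
  have "\<exists>K U. compactin X K \<and> openin Y U \<and> f ` K \<subseteq> U" for f
    by (rule exI[of _ "{}"], rule exI[of _ "{}"]) auto
  then show ?thesis
    unfolding compact_open_topology_def topology_generated_by_topspace by blast
qed

definition path_space :: "'a topology \<Rightarrow> (real \<Rightarrow> 'a) topology" where
  "path_space X = compact_open_topology (top_of_set {0..1}) X"

definition const_path :: "'a \<Rightarrow> real \<Rightarrow> 'a" where
  "const_path e = (\<lambda>t\<in>{0..1}. e)"

definition fibrewise_path_space :: "'e topology \<Rightarrow> ('e \<Rightarrow> 'b) \<Rightarrow> (real \<Rightarrow> 'e) topology" where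
  "fibrewise_path_space E p =
     subtopology (path_space E) {\<gamma>. \<forall>s\<in>{0..1}. \<forall>t\<in>{0..1}. p (\<gamma> s) = p (\<gamma> t)}"

definition fibre_product :: "'e topology \<Rightarrow> ('e \<Rightarrow> 'b) \<Rightarrow> ('e \<times> 'e) topology" where
  "fibre_product E p = subtopology (prod_topology E E) {(e1, e2). p e1 = p e2}"

definition endpoints :: "(real \<Rightarrow> 'e) \<Rightarrow> 'e \<times> 'e" where
  "endpoints \<gamma> = (\<gamma> 0, \<gamma> 1)"


section \<open>Numerical invariants\<close>

text \<open>The infimum in \<^typ>\<open>enat\<close> of the empty set is \<open>\<infinity>\<close>.\<close>

definition section_over ::
  "'x topology \<Rightarrow> 'y topology \<Rightarrow> ('x \<Rightarrow> 'y) \<Rightarrow> 'y set \<Rightarrow> ('y \<Rightarrow> 'x) \<Rightarrow> bool" where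
  "section_over X Y f U s \<longleftrightarrow> continuous_map (subtopology Y U) X s \<and> (\<forall>y\<in>U. f (s y) = y)"

definition sectional_category :: "'x topology \<Rightarrow> 'y topology \<Rightarrow> ('x \<Rightarrow> 'y) \<Rightarrow> enat" where
  "sectional_category X Y f = Inf {enat n | n. \<exists>U :: nat \<Rightarrow> 'y set.
     (\<Union>i\<le>n. U i) = topspace Y \<and>
     (\<forall>i\<le>n. openin Y (U i) \<and> (\<exists>s. section_over X Y f (U i) s))}"

text \<open>The topology of the base space of \<open>p\<close> plays no role in the next two definitions.\<close>

definition parametrized_TC :: "'e topology \<Rightarrow> ('e \<Rightarrow> 'b) \<Rightarrow> enat" where
  "parametrized_TC E p =
     sectional_category (fibrewise_path_space E p) (fibre_product E p) endpoints"

definition monoidal_parametrized_TC :: "'e topology \<Rightarrow> ('e \<Rightarrow> 'b) \<Rightarrow> enat" where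
  "monoidal_parametrized_TC E p = Inf {enat n | n. \<exists>U :: nat \<Rightarrow> ('e \<times> 'e) set.
     (\<Union>i\<le>n. U i) = topspace (fibre_product E p) \<and>
     (\<forall>i\<le>n. openin (fibre_product E p) (U i) \<and>
        (\<forall>e\<in>topspace E. (e, e) \<in> U i) \<and>
        (\<exists>s. section_over (fibrewise_path_space E p) (fibre_product E p) endpoints (U i) s \<and>
             (\<forall>e\<in>topspace E. s (e, e) = const_path e)))}"

definition TC :: "'a topology \<Rightarrow> enat" where
  "TC X = parametrized_TC X (\<lambda>_. ())"

definition monoidal_TC :: "'a topology \<Rightarrow> enat" where
  "monoidal_TC X = monoidal_parametrized_TC X (\<lambda>_. ())"

definition LS_cat :: "'a topology \<Rightarrow> enat" where
  "LS_cat X = Inf {enat n | n. \<exists>U :: nat \<Rightarrow> 'a set.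
     (\<Union>i\<le>n. U i) = topspace X \<and>
     (\<forall>i\<le>n. openin X (U i) \<and>
        (\<exists>c. homotopic_with (\<lambda>_. True) (subtopology X (U i)) X id (\<lambda>_. c)))}"

end

theory Submission
  imports Defs
begin

text \<open>
  All five numbers are squeezed between two copies of \<open>cat G\<close>, using
  \<open>cat G \<le> TC[p] \<le> TC\<^sup>M[p] \<le> cat G\<close> for \<open>p\<close> and for \<open>G \<rightarrow> *\<close>. Both outer inequalities rest
  on the continuous translation function, which sends \<open>(e, e g)\<close> in the fibre product to \<open>g\<close>.
  A section of \<open>\<Pi>\<close> evaluated at \<open>(e\<^sub>0, e\<^sub>0 g)\<close> and translated back to \<open>G\<close> is a path from \<open>1\<close>
  to \<open>g\<close>, so it contracts the set of all such \<open>g\<close>. Conversely, a contraction \<open>K\<close> of \<open>V\<close> to the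
  identity that fixes the identity gives the section \<open>(e, e g) \<mapsto> (t \<mapsto> e K(t, g))\<close>, which is constant
  on the diagonal; group translations, regularity and connectedness allow any categorical cover to be
  replaced by one with such pointed contractions.
\<close>


section \<open>The compact-open topology\<close>

text \<open>The preimage of the subbasic set of \<open>K\<close> and \<open>U\<close> consists of
  those \<open>z\<close> whose slice over \<open>K\<close> lies in the open set \<open>?W\<close>.
  As \<open>K\<close> is compact, the tube lemma thickens such a \<open>z\<close> to an open set.
  This turns a homotopy into a continuous family of paths.\<close>

lemma continuous_map_curry_compact_open:
  assumes f: "continuous_map (prod_topology Z X) Y f"
  shows "continuous_map Z (compact_open_topology X Y) (\<lambda>z. \<lambda>x\<in>topspace X. f (z, x))"
proof -
  let ?F = "\<lambda>z. \<lambda>x\<in>topspace X. f (z, x)"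
  have cF: "continuous_map X Y (?F z)" if "z \<in> topspace Z" for z
  proof (rule continuous_map_eq)
    show "continuous_map X Y (f \<circ> (\<lambda>x. (z, x)))"
      by (rule continuous_map_compose [OF _ f]) (simp add: continuous_map_pairwise o_def that)
  qed (auto simp: restrict_def)
  show ?thesis
    unfolding compact_open_topology_def
  proof (rule continuous_on_generated_topo)
    fix S
    assume "S \<in> {{f \<in> extensional (topspace X). continuous_map X Y f \<and> f ` K \<subseteq> U} | K U.
        compactin X K \<and> openin Y U}"
    then obtain K U where S: "S = {f \<in> extensional (topspace X). continuous_map X Y f \<and> f ` K \<subseteq> U}"
      and K: "compactin X K" and U: "openin Y U"
      by blast
    have KX: "K \<subseteq> topspace X"
      using K compactin_subset_topspace by blast
    let ?W = "{w \<in> topspace (prod_topology Z X). f w \<in> U}"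
    have W: "openin (prod_topology Z X) ?W"
      by (rule openin_continuous_map_preimage [OF f U])
    have eq: "?F -` S \<inter> topspace Z = {z \<in> topspace Z. {z} \<times> K \<subseteq> ?W}"
      using cF KX by (auto simp: S image_subset_iff subset_iff)
    show "openin Z (?F -` S \<inter> topspace Z)"
      unfolding eq
    proof (subst openin_subopen, clarify)
      fix z assume z: "z \<in> topspace Z" "{z} \<times> K \<subseteq> ?W"
      obtain M N where MN: "openin Z M" "z \<in> M" "K \<subseteq> N" "M \<times> N \<subseteq> ?W"
        using tube_lemma_right [OF W K z] by blast
      then have "M \<subseteq> {z \<in> topspace Z. {z} \<times> K \<subseteq> ?W}"
        using openin_subset by fastforce
      with MN show "\<exists>T. openin Z T \<and> z \<in> T \<and> T \<subseteq> {z \<in> topspace Z. {z} \<times> K \<subseteq> ?W}"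
        by blast
    qed
  next
    show "?F ` topspace Z \<subseteq> \<Union> {{f \<in> extensional (topspace X). continuous_map X Y f \<and> f ` K \<subseteq> U} | K U.
        compactin X K \<and> openin Y U}"
    proof
      fix g assume "g \<in> ?F ` topspace Z"
      then have "g \<in> topspace (compact_open_topology X Y)"
        unfolding topspace_compact_open_topology using cF by auto
      then show "g \<in> \<Union> {{f \<in> extensional (topspace X). continuous_map X Y f \<and> f ` K \<subseteq> U} | K U.
        compactin X K \<and> openin Y U}"
        unfolding compact_open_topology_def topology_generated_by_topspace .
    qed
  qed
qed

lemma openin_compact_open_subbasis:
  assumes "compactin X K" "openin Y U"
  shows "openin (compact_open_topology X Y)
    {f \<in> extensional (topspace X). continuous_map X Y f \<and> f ` K \<subseteq> U}"
  unfolding compact_open_topology_def using assms by (intro topology_generated_by_Basis) blast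

text \<open>A compact neighbourhood \<open>K\<close> of \<open>x\<close> that \<open>s z\<close>
  maps into \<open>U\<close> gives a subbasic set, and its preimage under \<open>s\<close> is a
  neighbourhood of \<open>z\<close> on which all of \<open>K\<close> still lands in
  \<open>U\<close>. This turns a section with values in paths into a homotopy.\<close>

lemma continuous_map_uncurry_compact_open:
  assumes s: "continuous_map Z (compact_open_topology X Y) s"
    and X: "neighbourhood_base_of (compactin X) X"
  shows "continuous_map (prod_topology Z X) Y (\<lambda>(z, x). s z x)"
proof -
  have cs: "continuous_map X Y (s z)" "s z \<in> extensional (topspace X)" if "z \<in> topspace Z" for z
    using continuous_map_image_subset_topspace [OF s] that
    unfolding topspace_compact_open_topology by auto
  show ?thesis
    unfolding continuous_map_def
  proof (intro conjI allI impI)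
    show "(\<lambda>(z, x). s z x) \<in> topspace (prod_topology Z X) \<rightarrow> topspace Y"
      using cs by (auto simp: continuous_map_def Pi_iff)
  next
    fix U assume U: "openin Y U"
    show "openin (prod_topology Z X)
      {w \<in> topspace (prod_topology Z X). (case w of (z, x) \<Rightarrow> s z x) \<in> U}"
      unfolding openin_prod_topology_alt
    proof clarify
      fix z x assume "(z, x) \<in> topspace (prod_topology Z X)" and sU: "s z x \<in> U"
      then have z: "z \<in> topspace Z" and x: "x \<in> topspace X" by auto
      have "openin X {x \<in> topspace X. s z x \<in> U}"
        by (rule openin_continuous_map_preimage [OF cs(1) [OF z] U])
      then obtain N K where N: "openin X N" "compactin X K" "x \<in> N" "N \<subseteq> K"
        "K \<subseteq> {x \<in> topspace X. s z x \<in> U}"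
        using X x sU unfolding neighbourhood_base_of by (metis (mono_tags, lifting) mem_Collect_eq)
      let ?S = "{f \<in> extensional (topspace X). continuous_map X Y f \<and> f ` K \<subseteq> U}"
      let ?M = "{z \<in> topspace Z. s z \<in> ?S}"
      have "openin Z ?M"
        by (rule openin_continuous_map_preimage [OF s openin_compact_open_subbasis [OF N(2) U]])
      moreover have "z \<in> ?M"
        using z cs N(5) by auto
      moreover have "?M \<times> N \<subseteq> {w \<in> topspace (prod_topology Z X). (case w of (z, x) \<Rightarrow> s z x) \<in> U}"
        using N openin_subset [OF N(1)] by (auto simp: image_subset_iff)
      ultimately show "\<exists>M N. openin Z M \<and> openin X N \<and> z \<in> M \<and> x \<in> N \<and>
          M \<times> N \<subseteq> {w \<in> topspace (prod_topology Z X). (case w of (z, x) \<Rightarrow> s z x) \<in> U}"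
        using N by blast
    qed
  qed
qed

abbreviation unit_interval :: "real topology" where
  "unit_interval \<equiv> top_of_set {0..1}"

lemma neighbourhood_base_unit_interval:
  "neighbourhood_base_of (compactin unit_interval) unit_interval"
proof -
  have "locally_compact_space unit_interval"
    by (rule compact_imp_locally_compact_space) (simp add: compact_space_subtopology)
  moreover have "Hausdorff_space unit_interval"
    by (simp add: Hausdorff_space_subtopology)
  ultimately show ?thesis
    by (simp add: locally_compact_imp_neighbourhood_base locally_compact_Hausdorff_imp_regular_space)
qed


section \<open>Contractible subsets of a topological group\<close>

locale topological_group = group G for G (structure) +
  fixes T
  assumes topspace_T [simp]: "topspace T = carrier G"
    and continuous_mult: "continuous_map (prod_topology T T) T (\<lambda>(x, y). x \<otimes> y)"
    and continuous_inv: "continuous_map T T (\<lambda>x. inv x)"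
begin

lemma continuous_map_mult:
  assumes "continuous_map X T f" "continuous_map X T g"
  shows "continuous_map X T (\<lambda>x. f x \<otimes> g x)"
proof -
  have "continuous_map X T ((\<lambda>(x, y). x \<otimes> y) \<circ> (\<lambda>x. (f x, g x)))"
    using assms by (intro continuous_map_compose [OF _ continuous_mult]) (simp add: continuous_map_pairedI)
  then show ?thesis by (simp add: o_def)
qed

lemma continuous_map_inv:
  assumes "continuous_map X T f"
  shows "continuous_map X T (\<lambda>x. inv (f x))"
  using continuous_map_compose [OF assms continuous_inv] by (simp add: o_def)

text \<open>By continuity of division, some open \<open>?N\<close> around the identity has all its
  quotients in \<open>U\<close>. Every point of its closure is such a quotient, so the closure
  serves as \<open>C\<close>.\<close>

lemma regular_at_one:
  assumes U: "openin T U" "\<one> \<in> U"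
  obtains N C where "openin T N" "closedin T C" "\<one> \<in> N" "N \<subseteq> C" "C \<subseteq> U"
proof -
  have "continuous_map (prod_topology T T) T (\<lambda>w. fst w \<otimes> inv (snd w))"
    by (intro continuous_map_mult continuous_map_inv continuous_map_fst continuous_map_snd)
  then have "openin (prod_topology T T) {w \<in> topspace (prod_topology T T). fst w \<otimes> inv (snd w) \<in> U}"
    by (rule openin_continuous_map_preimage) fact
  moreover have "(\<one>, \<one>) \<in> {w \<in> topspace (prod_topology T T). fst w \<otimes> inv (snd w) \<in> U}"
    using U by simp
  ultimately obtain V W where VW: "openin T V" "openin T W" "\<one> \<in> V" "\<one> \<in> W"
    "V \<times> W \<subseteq> {w \<in> topspace (prod_topology T T). fst w \<otimes> inv (snd w) \<in> U}"
    unfolding openin_prod_topology_alt by meson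
  let ?N = "V \<inter> W"
  have N: "openin T ?N" using VW by auto
  have Nc: "?N \<subseteq> carrier G" using openin_subset [OF N] by simp
  show ?thesis
  proof
    show "openin T ?N" "closedin T (T closure_of ?N)" "\<one> \<in> ?N"
      using N VW by auto
    show "?N \<subseteq> T closure_of ?N"
      using Nc by (simp add: closure_of_subset)
    show "T closure_of ?N \<subseteq> U"
    proof
      fix x assume x: "x \<in> T closure_of ?N"
      then have xc: "x \<in> carrier G"
        using closure_of_subset_topspace [of T ?N] by auto
      \<comment> \<open>The left translate of \<open>?N\<close> by \<open>x\<close> is a
        neighbourhood of \<open>x\<close>, so it meets \<open>?N\<close>; a common point
        \<open>y\<close> exhibits \<open>x\<close> as a quotient of two elements of
        \<open>?N\<close>.\<close>
      have "continuous_map T T (\<lambda>y. inv x \<otimes> y)"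
        using xc by (intro continuous_map_mult) auto
      then have "openin T {y \<in> topspace T. inv x \<otimes> y \<in> ?N}"
        using N by (rule openin_continuous_map_preimage)
      moreover have "x \<in> {y \<in> topspace T. inv x \<otimes> y \<in> ?N}"
        using xc VW by simp
      ultimately obtain y where "y \<in> ?N" "y \<in> {y \<in> topspace T. inv x \<otimes> y \<in> ?N}"
        using x unfolding in_closure_of by metis
      then have y: "y \<in> ?N" "y \<in> carrier G" "inv x \<otimes> y \<in> ?N"
        by auto
      then have "y \<otimes> inv (inv x \<otimes> y) \<in> U"
        using VW(5) by fastforce
      moreover have "y \<otimes> inv (inv x \<otimes> y) = x"
        using xc y by (simp add: inv_mult_group flip: m_assoc)
      ultimately show "x \<in> U" by simp
    qed
  qed
qed

text \<open>The contraction may leave \<open>U\<close>; only its start is confined there. Time runs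
  from the identity to \<open>x\<close>, so that \<open>act e (K (t, g))\<close> is a path from
  \<open>e\<close> to \<open>act e g\<close>.\<close>

definition contracts_to_one :: "'a set \<Rightarrow> (real \<times> 'a \<Rightarrow> 'a) \<Rightarrow> bool" where
  "contracts_to_one U K \<longleftrightarrow>
     continuous_map (prod_topology unit_interval (subtopology T U)) T K \<and>
     (\<forall>x\<in>U. K (0, x) = \<one> \<and> K (1, x) = x)"

definition pointed_contraction :: "'a set \<Rightarrow> (real \<times> 'a \<Rightarrow> 'a) \<Rightarrow> bool" where
  "pointed_contraction U K \<longleftrightarrow> contracts_to_one U K \<and> \<one> \<in> U \<and> (\<forall>t\<in>{0..1}. K (t, \<one>) = \<one>)"

lemma contracts_to_one_of_homotopic:
  assumes "homotopic_with (\<lambda>_. True) (subtopology T U) T (\<lambda>x. \<one>) id"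
  obtains K where "contracts_to_one U K"
  using assms unfolding homotopic_with_def contracts_to_one_def by auto

text \<open>Left translation makes any null-homotopy pointed.\<close>

lemma pointed_contraction_of_homotopic:
  assumes hom: "homotopic_with (\<lambda>_. True) (subtopology T U) T (\<lambda>x. c) id"
    and U: "\<one> \<in> U" and Uc: "U \<subseteq> carrier G"
  obtains K where "pointed_contraction U K"
proof -
  obtain H where H: "continuous_map (prod_topology unit_interval (subtopology T U)) T H"
    "\<And>x. H (0, x) = c" "\<And>x. H (1, x) = x"
    using hom unfolding homotopic_with_def by auto
  have c: "c \<in> carrier G"
    using continuous_map_image_subset_topspace [OF H(1)] H(2) [of \<one>] U by (auto simp: image_subset_iff)
  have H1: "H (t, \<one>) \<in> carrier G" if "t \<in> {0..1}" for t
    using continuous_map_image_subset_topspace [OF H(1)] U that by (auto simp: image_subset_iff)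
  let ?P = "prod_topology unit_interval (subtopology T U)"
  \<comment> \<open>The track of the identity is divided out: it starts at \<open>c\<close>, which
    makes the value at time 0 the identity, and ends at the identity, which leaves the value at time
    1 unchanged.\<close>
  let ?K = "\<lambda>w. inv (H (fst w, \<one>)) \<otimes> H w"
  have "continuous_map ?P ?P (\<lambda>w. (fst w, \<one>))"
    using U by (intro continuous_map_pairedI continuous_map_fst) auto
  then have "continuous_map ?P T (H \<circ> (\<lambda>w. (fst w, \<one>)))"
    by (rule continuous_map_compose) (rule H)
  then have "continuous_map ?P T ?K"
    by (intro continuous_map_mult continuous_map_inv H(1)) (simp add: o_def)
  moreover have "U \<subseteq> carrier G"
    by (rule Uc)
  ultimately have "pointed_contraction U ?K"
    unfolding pointed_contraction_def contracts_to_one_def using U c H H1 by auto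
  then show ?thesis ..
qed

lemma contracts_to_one_subset:
  assumes "contracts_to_one U K" "V \<subseteq> U"
  shows "contracts_to_one V K"
proof -
  have "continuous_map (prod_topology unit_interval (subtopology T V))
      (prod_topology unit_interval (subtopology T U)) id"
    using assms(2) by (auto simp: continuous_map_in_subtopology prod_topology_subtopology(2) 
      intro: continuous_map_from_subtopology)
  then have "continuous_map (prod_topology unit_interval (subtopology T V)) T (K \<circ> id)"
    by (rule continuous_map_compose) (use assms in \<open>simp add: contracts_to_one_def\<close>)
  then show ?thesis
    using assms unfolding contracts_to_one_def by auto
qed

text \<open>The pieces are open and do not overlap, so the pasting condition is vacuous. The glued
  map follows \<open>L\<close> on \<open>V\<close>, so it fixes the identity whenever that lies in
  \<open>V\<close> and \<open>L\<close> fixes it.\<close>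

lemma contracts_to_one_disjoint_Un:
  assumes U: "openin T U" "contracts_to_one U K" and V: "openin T V" "contracts_to_one V L"
    and disj: "U \<inter> V = {}"
  shows "contracts_to_one (U \<union> V) (\<lambda>w. if snd w \<in> V then L w else K w)"
proof -
  let ?X = "prod_topology unit_interval (subtopology T (U \<union> V))"
  let ?W = "\<lambda>b. if b then V else U"
  have sub: "subtopology ?X ({0..1} \<times> S) = prod_topology unit_interval (subtopology T S)"
    if "S \<subseteq> U \<union> V" for S
    using that by (simp add: subtopology_Times subtopology_subtopology inf_absorb2)
  have "continuous_map ?X T (\<lambda>w. if snd w \<in> V then L w else K w)"
  proof (rule pasting_lemma [where I = UNIV and T = "\<lambda>b. {0..1} \<times> ?W b" and f = "\<lambda>b. if b then L else K"])
    show "openin ?X ({0..1} \<times> ?W b)" for b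
      using U V openin_open_subtopology [of T "U \<union> V"]
      by (auto simp: openin_prod_Times_iff openin_Un)
    show "continuous_map (subtopology ?X ({0..1} \<times> ?W b)) T (if b then L else K)" for b
      using U V sub [of "?W b"] by (cases b) (auto simp: contracts_to_one_def)
  next
    fix w assume "w \<in> topspace ?X"
    then show "\<exists>b. b \<in> UNIV \<and> w \<in> {0..1} \<times> ?W b \<and>
        (if snd w \<in> V then L w else K w) = (if b then L else K) w"
      by (intro exI [of _ "snd w \<in> V"]) auto
  next
    fix a b w assume "w \<in> topspace ?X \<inter> {0..1} \<times> ?W a \<inter> {0..1} \<times> ?W b"
    then show "(if a then L else K) w = (if b then L else K) w"
      using disj by (cases a; cases b) auto
  qed
  then show ?thesis
    using U V disj unfolding contracts_to_one_def by auto
qed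

end

text \<open>The null-homotopy joins each point of \<open>U i\<close> to \<open>c i\<close>, so no
  \<open>U i\<close> meets two path components. Path components and their complements are then
  unions of members of the cover, hence open, and connectedness leaves only one component.\<close>

lemma path_connected_space_contractible_cover:
  assumes conn: "connected_space X"
    and cover: "topspace X \<subseteq> (\<Union>i\<in>I. U i)"
    and U: "\<And>i. i \<in> I \<Longrightarrow> openin X (U i)"
    and hom: "\<And>i. i \<in> I \<Longrightarrow> homotopic_with (\<lambda>_. True) (subtopology X (U i)) X id (\<lambda>_. c i)"
  shows "path_connected_space X"
  unfolding path_connected_space_iff_path_component
proof clarify
  fix x y assume x: "x \<in> topspace X" and y: "y \<in> topspace X"
  have pc: "path_component_of X u (c i)" if i: "i \<in> I" and u: "u \<in> U i" for u i
  proof -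
    have uX: "u \<in> topspace X"
      using openin_subset [OF U [OF i]] u by auto
    \<comment> \<open>Precomposing with the constant map at \<open>u\<close> leaves a homotopy
      between constant maps, which amounts to a path.\<close>
    have "homotopic_with (\<lambda>_. True) X X (id \<circ> (\<lambda>_. u)) ((\<lambda>_. c i) \<circ> (\<lambda>_. u))"
      by (rule homotopic_with_compose_continuous_map_right [OF hom [OF i]]) (use u uX in auto)
    then show ?thesis
      using uX by (auto simp: o_def homotopic_constant_maps)
  qed
  have same: "path_component_of X u v" if "i \<in> I" "u \<in> U i" "v \<in> U i" for u v i
    using pc that path_component_of_sym path_component_of_trans by metis
  let ?P = "{z \<in> topspace X. path_component_of X x z}"
  have "openin X ?P"
  proof (subst openin_subopen, clarify)
    fix z assume "z \<in> topspace X" and z: "path_component_of X x z"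
    then obtain i where i: "i \<in> I" "z \<in> U i"
      using cover by auto
    have "U i \<subseteq> ?P"
      using openin_subset [OF U] same i z path_component_of_trans by fast
    then show "\<exists>T. openin X T \<and> z \<in> T \<and> T \<subseteq> ?P"
      using U i by blast
  qed
  moreover have "openin X (topspace X - ?P)"
  proof (subst openin_subopen, intro ballI)
    fix z assume "z \<in> topspace X - ?P"
    then have zX: "z \<in> topspace X" and z: "\<not> path_component_of X x z"
      by auto
    then obtain i where i: "i \<in> I" "z \<in> U i"
      using cover by auto
    have "U i \<subseteq> topspace X - ?P"
      using openin_subset [OF U] same i z path_component_of_trans by fast
    then show "\<exists>T. openin X T \<and> z \<in> T \<and> T \<subseteq> topspace X - ?P"
      using U i by blast
  qed
  ultimately have "?P = {} \<or> ?P = topspace X"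
    using conn by (auto simp: connected_space_clopen_in closedin_def)
  moreover have "x \<in> ?P"
    using x by (simp add: path_component_of_refl)
  ultimately show "path_component_of X x y"
    using y by blast
qed

context topological_group
begin

text \<open>
  The member \<open>U k\<close> containing the identity is kept. From the others a closed neighbourhood \<open>C \<subseteq> U k\<close>
  of the identity is removed, and a smaller open one, contracting inside \<open>U k\<close>, is put back.
\<close>

lemma pointed_contraction_cover:
  assumes conn: "connected_space T"
    and cover: "(\<Union>i\<in>I. U i) = carrier G"
    and U: "\<And>i. i \<in> I \<Longrightarrow> openin T (U i)"
    and hom: "\<And>i. i \<in> I \<Longrightarrow> homotopic_with (\<lambda>_. True) (subtopology T (U i)) T id (\<lambda>_. c i)"
  obtains V K where "(\<Union>i\<in>I. V i) = carrier G"
    "\<And>i. i \<in> I \<Longrightarrow> openin T (V i)" "\<And>i. i \<in> I \<Longrightarrow> pointed_contraction (V i) (K i)"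
proof -
  obtain k where k: "k \<in> I" "\<one> \<in> U k"
    using cover one_closed by blast
  obtain L where L: "pointed_contraction (U k) L"
    using pointed_contraction_of_homotopic homotopic_with_symD [OF hom] k openin_subset [OF U] topspace_T
    by metis
  obtain N C where NC: "openin T N" "closedin T C" "\<one> \<in> N" "N \<subseteq> C" "C \<subseteq> U k"
    using regular_at_one [OF U [OF k(1)] k(2)] .
  have pconn: "path_connected_space T"
    by (rule path_connected_space_contractible_cover [OF conn _ U hom]) (use cover in auto)
  \<comment> \<open>A path from the identity to \<open>c i\<close> is prepended to the
    null-homotopy. An empty \<open>U i\<close> is treated apart, because then \<open>c i\<close> may
    lie outside the group.\<close>
  have ex: "\<exists>K. contracts_to_one (U i) K" if i: "i \<in> I" for i
  proof (cases "subtopology T (U i) = trivial_topology")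
    case True
    then have "homotopic_with (\<lambda>_. True) (subtopology T (U i)) T (\<lambda>x. \<one>) id"
      by (simp add: homotopic_on_empty)
    then show ?thesis using contracts_to_one_of_homotopic by metis
  next
    case False
    then have "c i \<in> carrier G"
      using homotopic_with_imp_continuous_maps [OF hom [OF i]] by (simp add: continuous_map_const)
    then have "path_component_of T \<one> (c i)"
      using pconn by (simp add: path_connected_space_iff_path_component)
    then have "homotopic_with (\<lambda>_. True) (subtopology T (U i)) T (\<lambda>_. \<one>) (\<lambda>_. c i)"
      by (simp add: homotopic_constant_maps)
    then have "homotopic_with (\<lambda>_. True) (subtopology T (U i)) T (\<lambda>_. \<one>) id"
      using homotopic_with_trans homotopic_with_symD [OF hom [OF i]] by blast
    then show ?thesis using contracts_to_one_of_homotopic by metis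
  qed
  \<comment> \<open>Since \<open>C\<close> is closed, \<open>U i - C\<close> stays open; since
    \<open>N\<close> lies in \<open>C\<close>, the two pieces are disjoint. The points lost with
    \<open>C\<close> remain covered by \<open>U k\<close>.\<close>
  define V where "V i = (if i = k then U k else (U i - C) \<union> N)" for i
  have Vo: "openin T (V i)" if "i \<in> I" for i
    using U [OF that] NC by (auto simp: V_def openin_diff)
  have "\<exists>K. pointed_contraction (V i) K" if i: "i \<in> I" for i
  proof (cases "i = k")
    case True
    then show ?thesis using L by (auto simp: V_def)
  next
    case False
    obtain K where K: "contracts_to_one (U i) K"
      using ex [OF i] by blast
    have "contracts_to_one ((U i - C) \<union> N) (\<lambda>w. if snd w \<in> N then L w else K w)"
    proof (rule contracts_to_one_disjoint_Un)
      show "contracts_to_one (U i - C) K"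
        using K by (rule contracts_to_one_subset) auto
      show "contracts_to_one N L"
        by (rule contracts_to_one_subset [of "U k"]) (use L NC in \<open>auto simp: pointed_contraction_def\<close>)
      show "openin T (U i - C)"
        using U [OF i] NC by (simp add: openin_diff)
    qed (use NC in auto)
    then show ?thesis
      using L NC False by (auto simp: V_def pointed_contraction_def)
  qed
  then obtain K where "\<And>i. i \<in> I \<Longrightarrow> pointed_contraction (V i) (K i)"
    by metis
  moreover have "(\<Union>i\<in>I. V i) = carrier G"
  proof
    show "(\<Union>i\<in>I. V i) \<subseteq> carrier G"
      using Vo openin_subset by fastforce
    show "carrier G \<subseteq> (\<Union>i\<in>I. V i)"
    proof
      fix x assume "x \<in> carrier G"
      then obtain i where i: "i \<in> I" "x \<in> U i" using cover by auto
      show "x \<in> (\<Union>i\<in>I. V i)"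
        using i k NC by (cases "x \<in> C") (auto simp: V_def split: if_splits)
    qed
  qed
  ultimately show ?thesis
    using that Vo by blast
qed

end


section \<open>The translation function of a principal bundle\<close>

locale topological_principal_bundle = topological_group G T for G (structure) and T +
  fixes E B p act
  assumes principal: "principal_bundle G T E B p act"
begin

lemma continuous_act:
  assumes "continuous_map X E f" "continuous_map X T g"
  shows "continuous_map X E (\<lambda>x. act (f x) (g x))"
proof -
  have "continuous_map X E ((\<lambda>(e, g). act e g) \<circ> (\<lambda>x. (f x, g x)))"
    using assms principal unfolding principal_bundle_def
    by (intro continuous_map_compose [where X' = "prod_topology E T"]) (auto simp: continuous_map_pairedI)
  then show ?thesis by (simp add: o_def)
qed

lemma act_closed: "e \<in> topspace E \<Longrightarrow> g \<in> carrier G \<Longrightarrow> act e g \<in> topspace E"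
  and act_one: "e \<in> topspace E \<Longrightarrow> act e \<one> = e"
  and p_act: "e \<in> topspace E \<Longrightarrow> g \<in> carrier G \<Longrightarrow> p (act e g) = p e"
  and p_closed: "e \<in> topspace E \<Longrightarrow> p e \<in> topspace B"
  using principal continuous_map_image_subset_topspace [of "prod_topology E T" E "\<lambda>(e, g). act e g"]
    continuous_map_image_subset_topspace [of E B p]
  unfolding principal_bundle_def by (auto simp: image_subset_iff)

text \<open>The definite description is meaningful only for two points of one fibre, where the
  action is free and transitive. Involving no trivialisation, it is one global function to which all
  local formulas can be compared.\<close>

definition translation :: "'c \<Rightarrow> 'c \<Rightarrow> 'a" where
  "translation e e' = (THE g. g \<in> carrier G \<and> act e g = e')"

text \<open>With \<open>f\<close> the group coordinate of a trivialisation, the action becomes right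
  multiplication, so the equation \<open>act e g = e'\<close> reads
  \<open>f e \<otimes> g = f e'\<close> and is solved uniquely. The last claim supplies a base point
  in the total space.\<close>

lemma translation_local:
  assumes "b \<in> topspace B"
  obtains U f where "openin B U" "b \<in> U" "continuous_map (subtopology E (p -` U)) T f"
    "\<And>e e'. \<lbrakk>e \<in> topspace E; e' \<in> topspace E; p e = p e'; p e \<in> U\<rbrakk> \<Longrightarrow>
       act e (inv (f e) \<otimes> f e') = e' \<and> translation e e' = inv (f e) \<otimes> f e'"
    "\<exists>e\<in>topspace E. p e = b"
proof -
  obtain U \<phi> where U: "openin B U" "b \<in> U"
    and \<phi>: "homeomorphic_map (subtopology E (p -` U)) (prod_topology (subtopology B U) T) \<phi>"
    and eq: "\<And>e. \<lbrakk>e \<in> topspace E; p e \<in> U\<rbrakk> \<Longrightarrow> fst (\<phi> e) = p e \<and>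
           (\<forall>g\<in>carrier G. \<phi> (act e g) = (fst (\<phi> e), snd (\<phi> e) \<otimes> g))"
    using principal assms unfolding principal_bundle_def by (smt (verit, best))
  have cont: "continuous_map (subtopology E (p -` U)) T (\<lambda>e. snd (\<phi> e))"
    using homeomorphic_imp_continuous_map [OF \<phi>] by (simp add: continuous_map_pairwise o_def)
  have snd_closed: "snd (\<phi> e) \<in> carrier G" if "e \<in> topspace E" "p e \<in> U" for e
    using continuous_map_image_subset_topspace [OF cont] that by (auto simp: image_subset_iff)
  have inj: "e = e'" if "e \<in> topspace E" "p e \<in> U" "e' \<in> topspace E" "p e' \<in> U" "\<phi> e = \<phi> e'" for e e'
    using homeomorphic_imp_injective_map [OF \<phi>] that by (auto simp: inj_on_def)
  have "act e (inv (snd (\<phi> e)) \<otimes> snd (\<phi> e')) = e' \<and>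
      translation e e' = inv (snd (\<phi> e)) \<otimes> snd (\<phi> e')"
    if e: "e \<in> topspace E" "e' \<in> topspace E" "p e = p e'" "p e \<in> U" for e e'
  proof -
    let ?g = "inv (snd (\<phi> e)) \<otimes> snd (\<phi> e')"
    have c: "snd (\<phi> e) \<in> carrier G" "snd (\<phi> e') \<in> carrier G"
      using snd_closed e by auto
    have "\<phi> (act e ?g) = \<phi> e'"
      using eq [of e] eq [of e'] c e by (auto simp: prod_eq_iff simp flip: m_assoc)
    then have act: "act e ?g = e'"
      using e c by (intro inj) (auto simp: act_closed p_act)
    have "translation e e' = ?g"
      unfolding translation_def
    proof (rule the_equality)
      fix h assume h: "h \<in> carrier G \<and> act e h = e'"
      then have "snd (\<phi> e') = snd (\<phi> e) \<otimes> h"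
        using eq [of e] e by auto
      then show "h = ?g"
        using c h by (simp flip: m_assoc)
    qed (use act c in auto)
    with act show ?thesis by simp
  qed
  moreover have "\<exists>e\<in>topspace E. p e = b"
  proof -
    \<comment> \<open>The trivialisation is onto, so the fibre over \<open>b\<close> contains the
      point with coordinates \<open>(b, \<one>)\<close>.\<close>
    have "(b, \<one>) \<in> \<phi> ` topspace (subtopology E (p -` U))"
      using homeomorphic_imp_surjective_map [OF \<phi>] assms U by auto
    then obtain e where "e \<in> topspace E" "p e \<in> U" "\<phi> e = (b, \<one>)"
      by auto
    then show ?thesis
      using eq [of e] by auto
  qed
  ultimately show ?thesis
    using that [OF U cont] by blast
qed

lemma
  assumes "e \<in> topspace E" "e' \<in> topspace E" "p e = p e'"
  shows translation_closed: "translation e e' \<in> carrier G"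
    and act_translation: "act e (translation e e') = e'"
proof -
  obtain U f where U: "p e \<in> U" "continuous_map (subtopology E (p -` U)) T f"
    "\<And>e e'. \<lbrakk>e \<in> topspace E; e' \<in> topspace E; p e = p e'; p e \<in> U\<rbrakk> \<Longrightarrow>
       act e (inv (f e) \<otimes> f e') = e' \<and> translation e e' = inv (f e) \<otimes> f e'"
    using translation_local [OF p_closed [OF assms(1)]] by metis
  have "f e \<in> carrier G" "f e' \<in> carrier G"
    using continuous_map_image_subset_topspace [OF U(2)] U(1) assms by (auto simp: image_subset_iff)
  then show "translation e e' \<in> carrier G" "act e (translation e e') = e'"
    using U(3) [OF assms U(1)] by auto
qed

text \<open>This is freeness of the action: in the group coordinate of a trivialisation, the factor
  of \<open>e\<close> cancels.\<close>

lemma translation_act: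
  assumes e: "e \<in> topspace E" and g: "g \<in> carrier G"
  shows "translation e (act e g) = g"
proof -
  obtain U \<phi> where U: "p e \<in> U"
    and \<phi>: "homeomorphic_map (subtopology E (p -` U)) (prod_topology (subtopology B U) T) \<phi>"
    and eq: "\<And>e. \<lbrakk>e \<in> topspace E; p e \<in> U\<rbrakk> \<Longrightarrow> fst (\<phi> e) = p e \<and>
           (\<forall>g\<in>carrier G. \<phi> (act e g) = (fst (\<phi> e), snd (\<phi> e) \<otimes> g))"
    using principal p_closed [OF e] unfolding principal_bundle_def by (smt (verit, best))
  have "\<phi> e \<in> topspace (prod_topology (subtopology B U) T)"
    using homeomorphic_imp_surjective_map [OF \<phi>] e U by auto
  then have c: "snd (\<phi> e) \<in> carrier G"
    by auto
  show ?thesis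
    unfolding translation_def
  proof (rule the_equality)
    fix h assume h: "h \<in> carrier G \<and> act e h = act e g"
    then have "snd (\<phi> e) \<otimes> h = snd (\<phi> e) \<otimes> g"
      using eq [OF e U] g by (metis snd_conv)
    then show "h = g"
      using c h g by simp
  qed (use g in auto)
qed

lemma translation_refl: "e \<in> topspace E \<Longrightarrow> translation e e = \<one>"
  using translation_act [of e \<one>] by (simp add: act_one)

lemma topspace_fibre_product:
  "topspace (fibre_product E p) = {(e, e'). e \<in> topspace E \<and> e' \<in> topspace E \<and> p e = p e'}"
  unfolding fibre_product_def by auto

text \<open>Over each trivialising set the local formula is continuous; on overlaps the formulas
  agree because all of them compute \<open>translation\<close>, so they paste together.\<close>

lemma continuous_translation:
  "continuous_map (fibre_product E p) T (\<lambda>(e, e'). translation e e')"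
proof -
  have "\<exists>U f. openin B U \<and> b \<in> U \<and> continuous_map (subtopology E (p -` U)) T f \<and>
    (\<forall>e e'. e \<in> topspace E \<longrightarrow> e' \<in> topspace E \<longrightarrow> p e = p e' \<longrightarrow> p e \<in> U \<longrightarrow>
       translation e e' = inv (f e) \<otimes> f e')" if "b \<in> topspace B" for b
    by (rule translation_local [OF that]) metis
  then obtain U f where U: "\<And>b. b \<in> topspace B \<Longrightarrow> openin B (U b)"
    "\<And>b. b \<in> topspace B \<Longrightarrow> b \<in> U b"
    and f: "\<And>b. b \<in> topspace B \<Longrightarrow> continuous_map (subtopology E (p -` U b)) T (f b)"
    and eq: "\<And>b e e'. \<lbrakk>b \<in> topspace B; e \<in> topspace E; e' \<in> topspace E; p e = p e'; p e \<in> U b\<rbrakk> \<Longrightarrow>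
       translation e e' = inv (f b e) \<otimes> f b e'"
    by metis
  let ?F = "fibre_product E p"
  let ?W = "\<lambda>b. {w \<in> topspace ?F. p (fst w) \<in> U b}"
  have cp: "continuous_map E B p"
    using principal unfolding principal_bundle_def by blast
  have cfst: "continuous_map ?F E fst" and csnd: "continuous_map ?F E snd"
    unfolding fibre_product_def
    by (auto intro: continuous_map_from_subtopology continuous_map_fst continuous_map_snd)
  show ?thesis
  proof (rule pasting_lemma [where I = "topspace B" and T = ?W
        and f = "\<lambda>b w. inv (f b (fst w)) \<otimes> f b (snd w)"])
    fix b assume b: "b \<in> topspace B"
    show "openin ?F (?W b)"
      using openin_continuous_map_preimage [OF continuous_map_compose [OF cfst cp] U(1) [OF b]]
      by simp
    have "continuous_map (subtopology ?F (?W b)) (subtopology E (p -` U b)) fst"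
      "continuous_map (subtopology ?F (?W b)) (subtopology E (p -` U b)) snd"
      by (auto simp: continuous_map_in_subtopology topspace_fibre_product
          intro!: continuous_map_from_subtopology cfst csnd)
    then have "continuous_map (subtopology ?F (?W b)) T (f b \<circ> fst)"
      "continuous_map (subtopology ?F (?W b)) T (f b \<circ> snd)"
      using f [OF b] continuous_map_compose by blast+
    then show "continuous_map (subtopology ?F (?W b)) T (\<lambda>w. inv (f b (fst w)) \<otimes> f b (snd w))"
      by (intro continuous_map_mult continuous_map_inv) (simp_all add: o_def)
  next
    fix w assume w: "w \<in> topspace ?F"
    then have b: "p (fst w) \<in> topspace B"
      by (auto simp: topspace_fibre_product p_closed)
    show "\<exists>j. j \<in> topspace B \<and> w \<in> ?W j \<and>
      (case w of (e, e') \<Rightarrow> translation e e') = inv (f j (fst w)) \<otimes> f j (snd w)"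
      using w b U(2) [OF b] eq [OF b, of "fst w" "snd w"]
      by (intro exI [of _ "p (fst w)"]) (auto simp: topspace_fibre_product)
  next
    fix a b w assume "a \<in> topspace B" "b \<in> topspace B" "w \<in> topspace ?F \<inter> ?W a \<inter> ?W b"
    then show "inv (f a (fst w)) \<otimes> f a (snd w) = inv (f b (fst w)) \<otimes> f b (snd w)"
      using eq [of a "fst w" "snd w"] eq [of b "fst w" "snd w"] by (auto simp: topspace_fibre_product)
  qed
qed


section \<open>Comparison of the invariants\<close>

text \<open>The cover is pulled back along \<open>j\<close>, which identifies \<open>G\<close> with
  the pairs in the fibre product whose first entry is \<open>e0\<close>. Motion planning from
  \<open>e0\<close> then becomes a contraction in \<open>G\<close>.\<close>

lemma LS_cat_le_parametrized_TC:
  assumes B: "topspace B \<noteq> {}"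
  shows "LS_cat T \<le> parametrized_TC E p"
  unfolding LS_cat_def parametrized_TC_def sectional_category_def
\<comment> \<open>A larger set has a smaller infimum, so each \<open>n\<close> realised by local
  sections has to be realised by a categorical cover.\<close>
proof (rule Inf_superset_mono, clarify)
  fix n and U :: "nat \<Rightarrow> ('c \<times> 'c) set"
  let ?F = "fibre_product E p"
  assume cover: "(\<Union>i\<le>n. U i) = topspace ?F"
    and U: "\<forall>i\<le>n. openin ?F (U i) \<and> (\<exists>s. section_over (fibrewise_path_space E p) ?F endpoints (U i) s)"
  obtain e0 where e0: "e0 \<in> topspace E"
    using B translation_local by (metis ex_in_conv)
  define j where "j = (\<lambda>g. (e0, act e0 g))"
  have j: "continuous_map T ?F j"
    unfolding j_def fibre_product_def
    using e0 by (auto simp: continuous_map_in_subtopology p_act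
        intro!: continuous_map_pairedI continuous_act)
  define V where "V i = {g \<in> carrier G. j g \<in> U i}" for i
  have "homotopic_with (\<lambda>_. True) (subtopology T (V i)) T id (\<lambda>_. \<one>)" if i: "i \<le> n" for i
  proof -
    obtain s where s: "section_over (fibrewise_path_space E p) ?F endpoints (U i) s"
      using U i by blast
    have "continuous_map (subtopology T (V i)) (subtopology ?F (U i)) j"
      by (auto simp: continuous_map_in_subtopology V_def intro: continuous_map_from_subtopology [OF j])
    then have "continuous_map (subtopology T (V i)) (fibrewise_path_space E p) (s \<circ> j)"
      using s unfolding section_over_def by (auto intro: continuous_map_compose)
    then have sj: "continuous_map (subtopology T (V i)) (compact_open_topology unit_interval E) (s \<circ> j)"
      and mem: "s \<circ> j \<in> topspace (subtopology T (V i)) \<rightarrow>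
        {\<gamma>. \<forall>a\<in>{0..1}. \<forall>b\<in>{0..1}. p (\<gamma> a) = p (\<gamma> b)}"
      unfolding fibrewise_path_space_def path_space_def continuous_map_in_subtopology
      by blast+
    \<comment> \<open>The planned path stays in the fibre of \<open>e0\<close>, so
      \<open>translation e0\<close> can be applied along all of it.\<close>
    have const: "p (s (j g) a) = p (s (j g) b)"
      if "g \<in> V i" "a \<in> {0..1}" "b \<in> {0..1}" for g a b
    proof -
      have "g \<in> topspace (subtopology T (V i))"
        using that by (simp add: V_def)
      from funcset_mem [OF mem this] show ?thesis
        using that by (metis (mono_tags, lifting) comp_apply mem_Collect_eq)
    qed
    have ends: "s (j g) 0 = e0" "s (j g) 1 = act e0 g" if "g \<in> V i" for g
      using s that unfolding section_over_def V_def endpoints_def by (auto simp: j_def)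
    let ?P = "prod_topology (subtopology T (V i)) unit_interval"
    have ev: "continuous_map ?P E (\<lambda>(g, t). (s \<circ> j) g t)"
      by (rule continuous_map_uncurry_compact_open [OF sj neighbourhood_base_unit_interval])
    have fib: "p e0 = p (s (j g) t)" if "g \<in> V i" "t \<in> {0..1}" for g t
      using const [of g 0 t] ends [of g] that by simp
    have "continuous_map ?P ?F (\<lambda>w. (e0, s (j (fst w)) (snd w)))"
      unfolding fibre_product_def continuous_map_in_subtopology
    proof
      show "continuous_map ?P (prod_topology E E) (\<lambda>w. (e0, s (j (fst w)) (snd w)))"
        using ev e0 by (intro continuous_map_pairedI) (auto simp: case_prod_unfold)
    qed (use fib in auto)
    from continuous_map_compose [OF this continuous_translation]
    have h: "continuous_map ?P T (\<lambda>w. translation e0 (s (j (fst w)) (snd w)))"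
      by (simp add: o_def)
    have "continuous_map (prod_topology unit_interval (subtopology T (V i))) ?P (\<lambda>w. (snd w, fst w))"
      by (intro continuous_map_pairedI continuous_map_fst continuous_map_snd)
    from continuous_map_compose [OF this h]
    have "continuous_map (prod_topology unit_interval (subtopology T (V i))) T
        (\<lambda>w. translation e0 (s (j (snd w)) (fst w)))"
      by (simp add: o_def)
    \<comment> \<open>Translating \<open>e0\<close> to itself gives the identity at time 0;
      translating \<open>e0\<close> to \<open>act e0 g\<close> gives \<open>g\<close> at time
      1.\<close>
    then have "homotopic_with (\<lambda>_. True) (subtopology T (V i)) T (\<lambda>_. \<one>) id"
      by (subst homotopic_with, simp)
        (rule exI [of _ "\<lambda>w. translation e0 (s (j (snd w)) (fst w))"],
          auto simp: ends translation_refl translation_act e0)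
    then show ?thesis
      by (rule homotopic_with_symD)
  qed
  moreover have "openin T (V i)" if "i \<le> n" for i
    using openin_continuous_map_preimage [OF j, of "U i"] U that by (simp add: V_def)
  moreover have "(\<Union>i\<le>n. V i) = topspace T"
    using cover continuous_map_image_subset_topspace [OF j] by (fastforce simp: V_def image_subset_iff)
  ultimately show "\<exists>m. enat n = enat m \<and> (\<exists>U. (\<Union>i\<le>m. U i) = topspace T \<and>
     (\<forall>i\<le>m. openin T (U i) \<and>
        (\<exists>c. homotopic_with (\<lambda>_. True) (subtopology T (U i)) T id (\<lambda>_. c))))"
    by blast
qed

text \<open>Dropping the two diagonal conditions only enlarges the set of admissible
  numbers.\<close>

lemma parametrized_TC_le_monoidal:
  "parametrized_TC E p \<le> monoidal_parametrized_TC E p"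
  unfolding parametrized_TC_def sectional_category_def monoidal_parametrized_TC_def
proof (rule Inf_superset_mono, rule subsetI, elim CollectE exE conjE)
  fix m n and U :: "nat \<Rightarrow> ('c \<times> 'c) set"
  assume m: "m = enat n" and U: "(\<Union>i\<le>n. U i) = topspace (fibre_product E p)"
    "\<forall>i\<le>n. openin (fibre_product E p) (U i) \<and>
        (\<forall>e\<in>topspace E. (e, e) \<in> U i) \<and>
        (\<exists>s. section_over (fibrewise_path_space E p) (fibre_product E p) endpoints (U i) s \<and>
             (\<forall>e\<in>topspace E. s (e, e) = const_path e))"
  have "\<forall>i\<le>n. openin (fibre_product E p) (U i) \<and>
        (\<exists>s. section_over (fibrewise_path_space E p) (fibre_product E p) endpoints (U i) s)"
    using U(2) by metis
  then show "m \<in> {enat n | n. \<exists>U :: nat \<Rightarrow> ('c \<times> 'c) set.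
     (\<Union>i\<le>n. U i) = topspace (fibre_product E p) \<and>
     (\<forall>i\<le>n. openin (fibre_product E p) (U i) \<and>
        (\<exists>s. section_over (fibrewise_path_space E p) (fibre_product E p) endpoints (U i) s))}"
    using m U(1) by (intro CollectI exI [of _ n] conjI exI [of _ U])
qed

text \<open>Pointed contractions in \<open>G\<close> are transported to every fibre at once through
  the action. Connectedness enters in making the categorical cover pointed.\<close>

lemma monoidal_parametrized_TC_le_LS_cat:
  assumes conn: "connected_space T"
  shows "monoidal_parametrized_TC E p \<le> LS_cat T"
  unfolding LS_cat_def monoidal_parametrized_TC_def
proof (rule Inf_superset_mono, clarify)
  fix n and U :: "nat \<Rightarrow> 'a set"
  let ?F = "fibre_product E p"
  assume cover: "(\<Union>i\<le>n. U i) = topspace T"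
    and U: "\<forall>i\<le>n. openin T (U i) \<and>
        (\<exists>c. homotopic_with (\<lambda>_. True) (subtopology T (U i)) T id (\<lambda>_. c))"
  obtain c where c: "\<And>i. i \<in> {..n} \<Longrightarrow> homotopic_with (\<lambda>_. True) (subtopology T (U i)) T id (\<lambda>_. c i)"
    using U by (metis atMost_iff)
  obtain V K where V: "(\<Union>i\<in>{..n}. V i) = carrier G"
    and Vo: "\<And>i. i \<in> {..n} \<Longrightarrow> openin T (V i)"
    and K: "\<And>i. i \<in> {..n} \<Longrightarrow> pointed_contraction (V i) (K i)"
    by (rule pointed_contraction_cover [OF conn, where I = "{..n}" and U = U and c = c]) (use U cover c in auto)
  \<comment> \<open>The translation function sends the diagonal to the identity, which lies in every
    \<open>V i\<close>; hence each \<open>W i\<close> contains the diagonal.\<close>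
  define W where "W i = {w \<in> topspace ?F. translation (fst w) (snd w) \<in> V i}" for i
  \<comment> \<open>The action moves \<open>fst w\<close> along the contraction of the translation
    element. The path stays in the fibre because \<open>act\<close> preserves \<open>p\<close>, and
    it is constant over the diagonal because \<open>K i\<close> fixes the identity.\<close>
  define s where "s i = (\<lambda>w. \<lambda>t\<in>{0..1}. act (fst w) (K i (t, translation (fst w) (snd w))))" for i
  have tr: "continuous_map ?F T (\<lambda>w. translation (fst w) (snd w))"
    using continuous_translation by (simp add: case_prod_unfold)
  have main: "openin ?F (W i) \<and> (\<forall>e\<in>topspace E. (e, e) \<in> W i) \<and>
      section_over (fibrewise_path_space E p) ?F endpoints (W i) (s i) \<and>
      (\<forall>e\<in>topspace E. s i (e, e) = const_path e)" if "i \<le> n" for i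
  proof (intro conjI ballI)
    have i: "i \<in> {..n}" using that by simp
    have Kc: "continuous_map (prod_topology unit_interval (subtopology T (V i))) T (K i)"
      and K0: "\<And>x. x \<in> V i \<Longrightarrow> K i (0, x) = \<one>" and K1: "\<And>x. x \<in> V i \<Longrightarrow> K i (1, x) = x"
      and one: "\<one> \<in> V i" and Kone: "\<And>t. t \<in> {0..1} \<Longrightarrow> K i (t, \<one>) = \<one>"
      using K [OF i] unfolding pointed_contraction_def contracts_to_one_def by auto
    have Kcl: "K i (t, x) \<in> carrier G" if "t \<in> {0..1}" "x \<in> V i" "x \<in> carrier G" for t x
      using continuous_map_image_subset_topspace [OF Kc] that by (auto simp: image_subset_iff)
    show "openin ?F (W i)"
      unfolding W_def by (rule openin_continuous_map_preimage [OF tr Vo [OF i]])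
    show "(e, e) \<in> W i" if "e \<in> topspace E" for e
      using that one by (simp add: W_def topspace_fibre_product translation_refl)
    show "s i (e, e) = const_path e" if "e \<in> topspace E" for e
      using that Kone by (auto simp: s_def const_path_def translation_refl act_one)
    let ?Z = "subtopology ?F (W i)"
    let ?P = "prod_topology ?Z unit_interval"
    have trW: "continuous_map ?Z (subtopology T (V i)) (\<lambda>w. translation (fst w) (snd w))"
      by (auto simp: continuous_map_in_subtopology W_def intro: continuous_map_from_subtopology [OF tr])
    have "continuous_map ?P (subtopology T (V i)) ((\<lambda>w. translation (fst w) (snd w)) \<circ> fst)"
      by (rule continuous_map_compose [OF continuous_map_fst trW])
    then have "continuous_map ?P (prod_topology unit_interval (subtopology T (V i)))
        (\<lambda>z. (snd z, translation (fst (fst z)) (snd (fst z))))"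
      by (intro continuous_map_pairedI continuous_map_snd) (simp add: o_def)
    from continuous_map_compose [OF this Kc]
    have "continuous_map ?P T (\<lambda>z. K i (snd z, translation (fst (fst z)) (snd (fst z))))"
      by (simp add: o_def)
    moreover have "continuous_map ?P E (\<lambda>z. fst (fst z))"
    proof -
      have "continuous_map ?Z E fst"
        unfolding fibre_product_def
        by (intro continuous_map_from_subtopology continuous_map_fst)
      from continuous_map_compose [OF continuous_map_fst this] show ?thesis
        by (simp add: o_def)
    qed
    ultimately have "continuous_map ?P E
        (\<lambda>z. act (fst (fst z)) (K i (snd z, translation (fst (fst z)) (snd (fst z)))))"
      by (intro continuous_act)
    from continuous_map_curry_compact_open [OF this]
    have sc: "continuous_map ?Z (path_space E) (s i)"
      by (simp add: path_space_def s_def)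
    have act_W: "fst w \<in> topspace E" "snd w \<in> topspace E" "p (fst w) = p (snd w)"
      "translation (fst w) (snd w) \<in> V i" "translation (fst w) (snd w) \<in> carrier G" if "w \<in> W i" for w
      using that by (auto simp: W_def topspace_fibre_product intro: translation_closed)
    show "section_over (fibrewise_path_space E p) ?F endpoints (W i) (s i)"
      unfolding section_over_def
    proof
      show "continuous_map ?Z (fibrewise_path_space E p) (s i)"
        unfolding fibrewise_path_space_def continuous_map_in_subtopology
        using sc act_W Kcl by (auto simp: s_def p_act)
      show "\<forall>w\<in>W i. endpoints (s i w) = w"
        using act_W K0 K1 by (auto simp: endpoints_def s_def act_one act_translation prod_eq_iff)
    qed
  qed
  moreover have "(\<Union>i\<le>n. W i) = topspace ?F"
  proof
    show "topspace ?F \<subseteq> (\<Union>i\<le>n. W i)"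
    proof
      fix w assume w: "w \<in> topspace ?F"
      then have "translation (fst w) (snd w) \<in> carrier G"
        by (auto simp: topspace_fibre_product intro: translation_closed)
      then show "w \<in> (\<Union>i\<le>n. W i)"
        using w by (auto simp: W_def simp flip: V)
    qed
  qed (auto simp: W_def)
  ultimately show "\<exists>m. enat n = enat m \<and> (\<exists>U :: nat \<Rightarrow> ('c \<times> 'c) set.
     (\<Union>i\<le>m. U i) = topspace ?F \<and>
     (\<forall>i\<le>m. openin ?F (U i) \<and> (\<forall>e\<in>topspace E. (e, e) \<in> U i) \<and>
        (\<exists>s. section_over (fibrewise_path_space E p) ?F endpoints (U i) s \<and>
             (\<forall>e\<in>topspace E. s (e, e) = const_path e))))"
    by (intro exI [of _ n] conjI refl exI [of _ W]) blast+
qed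

lemma parametrized_TC_eq_LS_cat:
  assumes "connected_space T" "topspace B \<noteq> {}"
  shows "parametrized_TC E p = LS_cat T" "monoidal_parametrized_TC E p = LS_cat T"
  using LS_cat_le_parametrized_TC [OF assms(2)] parametrized_TC_le_monoidal
    monoidal_parametrized_TC_le_LS_cat [OF assms(1)] by auto

end

text \<open>Right multiplication makes \<open>G\<close> a bundle with one global trivialisation.
  Since \<open>TC\<close> and \<open>monoidal_TC\<close> are defined through the constant map to
  \<open>()\<close>, the comparison for bundles applies to them.\<close>

lemma (in topological_group) principal_bundle_over_point:
  "principal_bundle G T T (discrete_topology {()}) (\<lambda>_. ()) (\<otimes>)"
proof -
  have "homeomorphic_maps T (prod_topology (discrete_topology {()}) T) (\<lambda>g. ((), g)) snd"
    unfolding homeomorphic_maps_def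
    by (auto simp: continuous_map_pairwise o_def intro: continuous_map_snd)
  then have "homeomorphic_map T (prod_topology (discrete_topology {()}) T) (\<lambda>g. ((), g))"
    using homeomorphic_map_maps by blast
  then show ?thesis
    unfolding principal_bundle_def using continuous_mult
    by (auto simp: m_assoc intro!: exI [of _ "{()}"] exI [of _ "\<lambda>g. ((), g)"])
qed

text \<open>\<open>smooth_map\<close> includes continuity, so multiplication and inversion are
  continuous.\<close>

lemma lie_group_imp_topological_group:
  assumes "lie_group G T n A"
  shows "topological_group G T"
proof -
  interpret group G
    using assms by (simp add: lie_group_def)
  show ?thesis
    using assms by unfold_locales (auto simp: lie_group_def smooth_map_def)
qed

text \<open>The base is taken non-empty because over an empty one the total space is empty and both
  invariants of \<open>p\<close> are 0, while the category of \<open>G\<close> may be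
  positive.\<close>

theorem proposition3p11:
  fixes G :: "('g, 'r) monoid_scheme" and TG :: "'g topology"
    and n :: nat and A :: "'g chart set"
    and E :: "'e topology" and B :: "'b topology"
    and p :: "'e \<Rightarrow> 'b" and act :: "'e \<Rightarrow> 'g \<Rightarrow> 'e"
  assumes "lie_group G TG n A"
    and "connected_space TG"
    and "principal_bundle G TG E B p act"
    and "topspace B \<noteq> {}"
  shows "monoidal_parametrized_TC E p = parametrized_TC E p
       \<and> parametrized_TC E p = monoidal_TC TG
       \<and> monoidal_TC TG = TC TG
       \<and> TC TG = LS_cat TG"
proof -
  interpret topological_group G TG
    using assms(1) by (rule lie_group_imp_topological_group)
  interpret total: topological_principal_bundle G TG E B p act
    using assms(3) by unfold_locales
  interpret point: topological_principal_bundle G TG TG "discrete_topology {()}" "\<lambda>_. ()" "(\<otimes>\<^bsub>G\<^esub>)"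
    using principal_bundle_over_point by unfold_locales
  show ?thesis
    using total.parametrized_TC_eq_LS_cat [OF assms(2,4)] point.parametrized_TC_eq_LS_cat [OF assms(2)]
    by (simp add: TC_def monoidal_TC_def)
qed

end
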